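(* Let $A$ be a non-degenerate evolution $\mathbb{K}$-algebra with natural basis $B$ and associated directed graph $E$ relative to $B$, and let $H\subset E^0$ be a hereditary and saturated set. Then the ideal $I_H$ has the absorption property.
   Context: An evolution algebra over a field $\mathbb{K}$ is a (not necessarily associative or finite-dimensional) $\mathbb{K}$-algebra $A$ having a basis $B=\{e_i\}_{i\in\Lambda}$, called a natural basis, with $e_ie_j=0$ whenever $i\neq j$. $A$ is non-degenerate if $\{x\in A: xA=0\}=0$ (equivalently $e_i^2\neq 0$ for all $i\in\Lambda$). The associated directed graph $E$ relative to $B$ has vertex set $E^0=B$ and exactly one edge from $e_i$ to $e_j$ if the coefficient of $e_j$ in $e_i^2$ is nonzero, and no edge otherwise; $s(f)$, $r(f)$ denote the source and range of an edge $f$. A subset $H\subset E^0$ is hereditary if, for every $u\in H$, every vertex reachable from $u$ by a directed path belongs to $H$. A vertex $u$ is regular if $0<|s^{-1}(u)|<\infty$. $H$ is saturated if for every regular vertex $u\in E^0$, $r(s^{-1}(u))\subset H$ implies $u\in H$. For a hereditary $H$, $I_H:=\operatorname{span}(H)$ (an ideal of $A$), with $I_\emptyset=\{0\}$. An ideal $I$ of a commutative algebra $A$ has the absorption property if $xA\subset I$ implies $x\in I$. *)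

theory Defs
  imports "HOL.Vector_Spaces" "Graph_Theory.Digraph"
begin

text \<open>
  An algebra over a field: neither associativity, commutativity, a unit, nor finite dimension
  is required. The library classes for algebras all build in associativity, so the product is a
  locale parameter.
\<close>

locale nonassoc_algebra = vector_space scale
  for scale :: "'k::field \<Rightarrow> 'a::ab_group_add \<Rightarrow> 'a" (infixr \<open>*s\<close> 75) +
  fixes mult :: "'a \<Rightarrow> 'a \<Rightarrow> 'a" (infixl \<open>\<odot>\<close> 70)
  assumes linear_mult_left: "Vector_Spaces.linear scale scale (\<lambda>x. x \<odot> y)"
    and linear_mult_right: "Vector_Spaces.linear scale scale (\<lambda>y. x \<odot> y)"
begin

definition natural_basis :: "'a set \<Rightarrow> bool" where
  "natural_basis B \<longleftrightarrow>
     independent B \<and> span B = UNIV \<and> (\<forall>u\<in>B. \<forall>v\<in>B. u \<noteq> v \<longrightarrow> u \<odot> v = 0)"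

definition non_degenerate :: bool where
  "non_degenerate \<longleftrightarrow> {x. \<forall>a. x \<odot> a = 0} = {0}"

definition ideal :: "'a set \<Rightarrow> bool" where
  "ideal I \<longleftrightarrow> subspace I \<and> (\<forall>x\<in>I. \<forall>a. a \<odot> x \<in> I \<and> x \<odot> a \<in> I)"

text \<open>
  The absorption property is a property of ideals, so being an ideal is part of the predicate.
  It is used for commutative algebras only, where the side of the multiplication is immaterial.
\<close>

definition absorption_property :: "'a set \<Rightarrow> bool" where
  "absorption_property I \<longleftrightarrow> ideal I \<and> (\<forall>x. (\<forall>a. x \<odot> a \<in> I) \<longrightarrow> x \<in> I)"

text \<open>
  The edge from \<open>u\<close> to \<open>v\<close> is the pair \<open>(u, v)\<close>, so there is at most one; \<open>representation B x v\<close>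
  is the coefficient of \<open>v\<close> in the expansion of \<open>x\<close> with respect to the basis \<open>B\<close>.
\<close>

definition associated_digraph :: "'a set \<Rightarrow> ('a, 'a \<times> 'a) pre_digraph" where
  "associated_digraph B =
     \<lparr> verts = B,
       arcs = {(u, v). u \<in> B \<and> v \<in> B \<and> representation B (u \<odot> u) v \<noteq> 0},
       tail = fst,
       head = snd \<rparr>"

end

definition hereditary :: "('v, 'e) pre_digraph \<Rightarrow> 'v set \<Rightarrow> bool" where
  "hereditary G H \<longleftrightarrow> H \<subseteq> verts G \<and> (\<forall>u\<in>H. \<forall>v. u \<rightarrow>\<^sup>*\<^bsub>G\<^esub> v \<longrightarrow> v \<in> H)"

definition regular_vertex :: "('v, 'e) pre_digraph \<Rightarrow> 'v \<Rightarrow> bool" where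
  "regular_vertex G u \<longleftrightarrow> u \<in> verts G \<and> out_arcs G u \<noteq> {} \<and> finite (out_arcs G u)"

definition saturated :: "('v, 'e) pre_digraph \<Rightarrow> 'v set \<Rightarrow> bool" where
  "saturated G H \<longleftrightarrow>
     (\<forall>u. regular_vertex G u \<longrightarrow> head G ` out_arcs G u \<subseteq> H \<longrightarrow> u \<in> H)"

end

theory Submission
  imports Defs
begin

text \<open>
  Write \<open>x\<close> in the natural basis \<open>B\<close> and let \<open>v \<in> B\<close>. Only the \<open>v\<close>-term of \<open>x\<close> survives
  multiplication by \<open>v\<close>, so \<open>x \<odot> v\<close> is the \<open>v\<close>-coefficient of \<open>x\<close> times \<open>v \<odot> v\<close>
  (\<open>mult_natural_basis_right\<close>). Hence if \<open>x\<close> multiplies the whole algebra into \<open>span H\<close>, then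
  \<open>v \<odot> v \<in> span H\<close> for every \<open>v\<close> in the support of \<open>x\<close>, that is, all edges leaving such a \<open>v\<close> end
  in \<open>H\<close>. There are finitely many of them because supports are finite, and at least one because
  non-degeneracy makes \<open>v \<odot> v\<close> nonzero. So \<open>v\<close> is a regular vertex and saturation puts it in \<open>H\<close>
  (\<open>saturated_square\<close>). The support of \<open>x\<close> therefore lies in \<open>H\<close>, and \<open>x \<in> span H\<close>.

  That \<open>span H\<close> is an ideal is the dual use of the same dictionary between squares and edges:
  heredity says that the squares of the vertices in \<open>H\<close> stay in \<open>span H\<close>
  (\<open>hereditary_square\<close>).
\<close>

lemma reachable_arc:
  assumes "e \<in> arcs G" "tail G e \<in> verts G" "head G e \<in> verts G"
  shows "tail G e \<rightarrow>\<^sup>*\<^bsub>G\<^esub> head G e"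
proof -
  have "(tail G e, head G e) \<in> arcs_ends G"
    using assms(1) by (auto simp: arcs_ends_def arc_to_ends_def)
  then show ?thesis
    unfolding reachable_def
    using rtrancl_on_into_rtrancl_on[OF rtrancl_on_refl] assms(2,3) by metis
qed

lemma (in vector_space) span_subset_basis_iff:
  assumes "independent B" "S \<subseteq> B" "x \<in> span B"
  shows "x \<in> span S \<longleftrightarrow> {b. representation B x b \<noteq> 0} \<subseteq> S"
proof
  assume "x \<in> span S"
  then have "representation B x = representation S x"
    by (rule representation_extend[OF assms(1) _ assms(2)])
  then show "{b. representation B x b \<noteq> 0} \<subseteq> S"
    by (auto dest: representation_ne_zero)
next
  assume "{b. representation B x b \<noteq> 0} \<subseteq> S"
  then have "(\<Sum>b | representation B x b \<noteq> 0. scale (representation B x b) b) \<in> span S"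
    by (intro span_sum span_scale span_base) auto
  then show "x \<in> span S"
    by (simp add: sum_nonzero_representation_eq[OF assms(1,3)])
qed

context nonassoc_algebra
begin

lemma mult_add_left: "(x + y) \<odot> z = x \<odot> z + y \<odot> z"
  and mult_scale_left: "(c *s x) \<odot> z = c *s (x \<odot> z)"
  using linear_mult_left[of z] unfolding Vector_Spaces.linear_iff by blast+

lemma mult_zero_left: "0 \<odot> z = 0"
  using mult_add_left[of 0 0 z] by simp

lemma mult_add_right: "z \<odot> (x + y) = z \<odot> x + z \<odot> y"
  and mult_scale_right: "z \<odot> (c *s x) = c *s (z \<odot> x)"
  using linear_mult_right[of z] unfolding Vector_Spaces.linear_iff by blast+

lemma mult_zero_right: "z \<odot> 0 = 0"
  using mult_add_right[of z 0 0] by simp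

text \<open>
  A product of spans is controlled by bilinearity alone; this is what reduces both the ideal
  property and the annihilator of a basis vector to products of basis vectors.
\<close>

lemma mult_span_in_subspace:
  assumes W: "subspace W"
    and gen: "\<And>u v. u \<in> S \<Longrightarrow> v \<in> T \<Longrightarrow> u \<odot> v \<in> W"
    and x: "x \<in> span S" and y: "y \<in> span T"
  shows "x \<odot> y \<in> W"
  using x
proof (induction rule: span_induct)
  case base
  show ?case
    using W by (auto simp: subspace_def mult_add_left mult_scale_left mult_zero_left)
next
  case (step u)
  show ?case
    using y
  proof (induction rule: span_induct)
    case base
    show ?case
      using W by (auto simp: subspace_def mult_add_right mult_scale_right mult_zero_right)
  next
    case (step v)
    then show ?case using gen \<open>u \<in> S\<close> by blast
  qed
qed

context
  fixes B :: "'a set"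
  assumes B: "natural_basis B"
begin

lemma natural_basis_independent: "independent B"
  and in_span_natural_basis: "x \<in> span B"
  and natural_basis_mult_eq_0: "u \<in> B \<Longrightarrow> v \<in> B \<Longrightarrow> u \<noteq> v \<Longrightarrow> u \<odot> v = 0"
  using B by (auto simp: natural_basis_def)

lemma mult_natural_basis_right:
  assumes "v \<in> B"
  shows "x \<odot> v = representation B x v *s (v \<odot> v)"
  using in_span_natural_basis[of x]
proof (induction rule: span_induct)
  case base
  show ?case
    by (auto simp: subspace_def mult_add_left mult_scale_left mult_zero_left
        representation_zero representation_add representation_scale
        natural_basis_independent in_span_natural_basis scale_left_distrib)
next
  case (step u)
  then show ?case
    using assms natural_basis_mult_eq_0
    by (simp add: representation_basis natural_basis_independent)
qed

lemma square_nonzero: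
  assumes "non_degenerate" "u \<in> B"
  shows "u \<odot> u \<noteq> 0"
proof
  assume "u \<odot> u = 0"
  then have "u \<odot> v \<in> {0}" if "v \<in> B" for v
    using natural_basis_mult_eq_0[of u v] assms(2) that by (cases "u = v") auto
  then have "u \<odot> a \<in> {0}" for a
    by (intro mult_span_in_subspace[OF subspace_single_0 _ span_base[of u "{u}"]
          in_span_natural_basis]) simp_all
  then have "u = 0"
    using assms(1) by (auto simp: non_degenerate_def)
  then show False
    using assms(2) natural_basis_independent dependent_zero by blast
qed

lemma out_arcs_associated_digraph:
  assumes "u \<in> B"
  shows "out_arcs (associated_digraph B) u = Pair u ` {v. representation B (u \<odot> u) v \<noteq> 0}"
  using assms by (auto simp: associated_digraph_def out_arcs_def dest: representation_ne_zero)

lemma square_in_span_iff: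
  assumes "u \<in> B" "H \<subseteq> B"
  shows "u \<odot> u \<in> span H \<longleftrightarrow>
    head (associated_digraph B) ` out_arcs (associated_digraph B) u \<subseteq> H"
proof -
  have "head (associated_digraph B) ` out_arcs (associated_digraph B) u
      = {v. representation B (u \<odot> u) v \<noteq> 0}"
    unfolding out_arcs_associated_digraph[OF assms(1)]
    by (simp add: associated_digraph_def image_image)
  then show ?thesis
    by (simp add: span_subset_basis_iff[OF natural_basis_independent assms(2) in_span_natural_basis])
qed

text \<open>
  Over a field every basis expansion is finite, so a vertex of an associated digraph can only
  fail to be regular by being a sink, and sinks are the basis vectors of square zero.
\<close>

lemma regular_vertex_associated_digraph:
  assumes "u \<in> B" "u \<odot> u \<noteq> 0"
  shows "regular_vertex (associated_digraph B) u"
proof -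
  have "{v. representation B (u \<odot> u) v \<noteq> 0} \<noteq> {}"
    \<comment> \<open>A vector with empty support lies in the span of the empty set.\<close>
    using span_subset_basis_iff[OF natural_basis_independent empty_subsetI
        in_span_natural_basis[of "u \<odot> u"]] assms(2)
    by auto
  then show ?thesis
    unfolding regular_vertex_def out_arcs_associated_digraph[OF assms(1)]
    using assms(1) finite_representation[of B "u \<odot> u"]
    by (simp add: associated_digraph_def)
qed

lemma hereditary_square:
  assumes "hereditary (associated_digraph B) H" "u \<in> H"
  shows "u \<odot> u \<in> span H"
proof -
  let ?G = "associated_digraph B"
  have HB: "H \<subseteq> B"
    using assms(1) by (simp add: hereditary_def associated_digraph_def)
  have "head ?G e \<in> H" if "e \<in> out_arcs ?G u" for e
  proof -
    have "u \<rightarrow>\<^sup>*\<^bsub>?G\<^esub> head ?G e"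
      using reachable_arc[of e ?G] that by (auto simp: associated_digraph_def)
    then show ?thesis
      using assms by (auto simp: hereditary_def)
  qed
  then show ?thesis
    using square_in_span_iff[of u H] HB assms(2) by blast
qed

lemma saturated_square:
  assumes "saturated (associated_digraph B) H" "H \<subseteq> B"
    and "u \<in> B" "u \<odot> u \<noteq> 0" "u \<odot> u \<in> span H"
  shows "u \<in> H"
  using assms(1) square_in_span_iff[OF assms(3,2)] assms(5)
    regular_vertex_associated_digraph[OF assms(3,4)]
  by (simp add: saturated_def)

lemma ideal_span_hereditary:
  assumes "hereditary (associated_digraph B) H"
  shows "ideal (span H)"
proof -
  have HB: "H \<subseteq> B"
    using assms by (simp add: hereditary_def associated_digraph_def)
  have gen: "u \<odot> v \<in> span H \<and> v \<odot> u \<in> span H" if "u \<in> H" "v \<in> B" for u v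
  proof (cases "u = v")
    case True
    then show ?thesis
      using hereditary_square[OF assms that(1)] by simp
  next
    case False
    have "u \<in> B"
      using HB that(1) by (rule subsetD)
    then show ?thesis
      using that(2) False by (simp add: natural_basis_mult_eq_0 span_zero)
  qed
  have "x \<odot> a \<in> span H" if "x \<in> span H" for x a
    by (rule mult_span_in_subspace[OF subspace_span _ that in_span_natural_basis]) (simp add: gen)
  moreover have "a \<odot> x \<in> span H" if "x \<in> span H" for x a
    by (rule mult_span_in_subspace[OF subspace_span _ in_span_natural_basis that]) (simp add: gen)
  ultimately show ?thesis
    unfolding ideal_def using subspace_span by blast
qed

lemma absorption_property_span:
  assumes "non_degenerate"
    and her: "hereditary (associated_digraph B) H"
    and sat: "saturated (associated_digraph B) H"
  shows "absorption_property (span H)"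
  unfolding absorption_property_def
proof (intro conjI allI impI)
  show "ideal (span H)"
    by (rule ideal_span_hereditary[OF her])
next
  fix x
  assume x: "\<forall>a. x \<odot> a \<in> span H"
  have HB: "H \<subseteq> B"
    using her by (simp add: hereditary_def associated_digraph_def)
  have "v \<in> H" if c: "representation B x v \<noteq> 0" for v
  proof -
    have v: "v \<in> B"
      using c by (rule representation_ne_zero)
    have "representation B x v *s (v \<odot> v) \<in> span H"
      using x mult_natural_basis_right[OF v, of x] by metis
    then have "v \<odot> v \<in> span H"
      using span_scale[of "representation B x v *s (v \<odot> v)" H "inverse (representation B x v)"] c
      by simp
    then show ?thesis
      by (rule saturated_square[OF sat HB v square_nonzero[OF assms(1) v]])
  qed
  then show "x \<in> span H"
    by (subst span_subset_basis_iff[OF natural_basis_independent HB in_span_natural_basis]) auto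
qed

end

end

theorem proposition5p2:
  fixes scale :: "'k::field \<Rightarrow> 'a::ab_group_add \<Rightarrow> 'a"
    and mult :: "'a \<Rightarrow> 'a \<Rightarrow> 'a"
    and B H :: "'a set"
  assumes "nonassoc_algebra scale mult"
    and "nonassoc_algebra.natural_basis scale mult B"
    and "nonassoc_algebra.non_degenerate mult"
    and "H \<subseteq> B"
    and "hereditary (nonassoc_algebra.associated_digraph scale mult B) H"
    and "saturated (nonassoc_algebra.associated_digraph scale mult B) H"
  shows "nonassoc_algebra.absorption_property scale mult (module.span scale H)"
  using nonassoc_algebra.absorption_property_span[OF assms(1-3,5,6)] .

end
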